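(* Let $\lambda^{(m)}$ be an $m$-partition of size $n$. The $\mathfrak{R}$-bilinear form $\langle,\rangle_{\mathrm{bilin}}$ on $U_{\lambda^{(m)}}$ determined by $\langle\mathcal{X}_{\lambda^{(m)}},\mathcal{X}'_{\lambda^{(m)}}\rangle=0$ for different standard $m$-tableaux $X_{\lambda^{(m)}}\neq X'_{\lambda^{(m)}}$ of shape $\lambda^{(m)}$ and $$\langle\mathcal{X}_{\lambda^{(m)}},\mathcal{X}_{\lambda^{(m)}}\rangle=\prod_{j<k,\ c^{(j)}\neq c^{(k)},\ c^{(j)}\neq c^{(k)}q^{\pm2}}\frac{q^{-1}c^{(j)}-q\,c^{(k)}}{c^{(j)}-c^{(k)}},\qquad c^{(i)}:=c(X_{\lambda^{(m)}}|i),$$ is $\mathsf{S}^-$-invariant for $\mathsf{S}=\{\tau,\sigma_1,\dots,\sigma_{n-1}\}$; that is, $\langle \mathsf{a}(u),\mathsf{a}^{-1}(v)\rangle_{\mathrm{bilin}}=\langle u,v\rangle_{\mathrm{bilin}}$ for all $u,v\in U_{\lambda^{(m)}}$ and all $\mathsf{a}\in\{\tau,\sigma_1,\dots,\sigma_{n-1}\}$.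
   Context: Ring. Let $m,n\geq1$ and let $q,v_1,\dots,v_m$ be indeterminates. $\mathfrak{R}$ is the localization of $\mathbb{C}[q^{\pm1},v_1^{\pm1},\dots,v_m^{\pm1}]$ with respect to the multiplicative set generated by $\{1+q^2+\dots+q^{2N}\}_{N=1,\dots,n}\cup\{q^{2i}v_j-v_k\}_{j\neq k,\,-n<i<n}$. Algebra. $H(m,1,n)$ is here the associative unital $\mathfrak{R}$-algebra generated by $\tau,\sigma_1,\dots,\sigma_{n-1}$ with relations $\sigma_i\sigma_{i+1}\sigma_i=\sigma_{i+1}\sigma_i\sigma_{i+1}$; $\sigma_i\sigma_j=\sigma_j\sigma_i$ if $|i-j|>1$; $\tau\sigma_1\tau\sigma_1=\sigma_1\tau\sigma_1\tau$; $\tau\sigma_i=\sigma_i\tau$ for $i>1$; $\sigma_i^2=(q-q^{-1})\sigma_i+1$; $(\tau-v_1)\cdots(\tau-v_m)=0$. The generators are invertible. Tableaux. An $m$-partition of $n$ is an $m$-tuple $\lambda^{(m)}=(\lambda_1,\dots,\lambda_m)$ of partitions with $|\lambda_1|+\dots+|\lambda_m|=n$. The content of the node in row $r$ and column $s$ of the $k$-th diagram is $v_kq^{2(s-r)}$. A standard $m$-tableau of shape $\lambda^{(m)}$ is a bijective filling of all nodes with $1,\dots,n$ such that in every diagram the numbers increase along rows (to the right) and columns (downwards). $c(X_{\lambda^{(m)}}|i)$ is the content of the node carrying $i$ in $X_{\lambda^{(m)}}$; $X_{\lambda^{(m)}}^{s_i}$ is obtained by exchanging $i$ and $i+1$. Module.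 $U_{\lambda^{(m)}}$ is the free $\mathfrak{R}$-module with basis $\{\mathcal{X}_{\lambda^{(m)}}\}$ indexed by the standard $m$-tableaux of shape $\lambda^{(m)}$, with the $H(m,1,n)$-action (with $c^{(i)}:=c(X_{\lambda^{(m)}}|i)$) $$\tau(\mathcal{X}_{\lambda^{(m)}})=c^{(1)}\mathcal{X}_{\lambda^{(m)}},\qquad \sigma_i(\mathcal{X}_{\lambda^{(m)}})=\frac{(q-q^{-1})c^{(i+1)}}{c^{(i+1)}-c^{(i)}}\mathcal{X}_{\lambda^{(m)}}+\frac{qc^{(i+1)}-q^{-1}c^{(i)}}{c^{(i+1)}-c^{(i)}}\mathcal{X}_{\lambda^{(m)}}^{s_i},$$ where $\mathcal{X}_{\lambda^{(m)}}^{s_i}$ is the basis vector of $X_{\lambda^{(m)}}^{s_i}$ if it is standard and $0$ otherwise. *)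

theory Defs
  imports
    Complex_Main
    "HOL-Library.Poly_Mapping"
    "HOL-Computational_Algebra.Fraction_Field"
    "HOL-Combinatorics.Transposition"
    "HOL-Algebra.QuotRing"
    "HOL-Algebra.Module"
begin

section \<open>The ground ring\<close>

text \<open>
  All scalars live in the field of rational functions over the complex numbers in countably many
  variables: variable 0 is \<open>q\<close>, variable \<open>j \<ge> 1\<close> is \<open>v\<^sub>j\<close>.  Since the Laurent polynomial ring is an
  integral domain and the denominators below are nonzero, its localization is a subring of this field.
\<close>

type_synonym ratfun = "((nat \<Rightarrow>\<^sub>0 nat) \<Rightarrow>\<^sub>0 complex) fract"

definition indet :: "nat \<Rightarrow> ratfun" where
  "indet j = Fract (Poly_Mapping.single (Poly_Mapping.single j 1) 1) 1"

definition cnst :: "complex \<Rightarrow> ratfun" where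
  "cnst z = Fract (Poly_Mapping.single 0 z) 1"

definition q :: ratfun where "q = indet 0"

definition v :: "nat \<Rightarrow> ratfun" where "v j = indet j"

inductive_set laurent :: "nat \<Rightarrow> ratfun set" for m :: nat where
  cnst: "cnst z \<in> laurent m"
| q: "q \<in> laurent m"
| q_inverse: "inverse q \<in> laurent m"
| v: "1 \<le> j \<Longrightarrow> j \<le> m \<Longrightarrow> v j \<in> laurent m"
| v_inverse: "1 \<le> j \<Longrightarrow> j \<le> m \<Longrightarrow> inverse (v j) \<in> laurent m"
| add: "x \<in> laurent m \<Longrightarrow> y \<in> laurent m \<Longrightarrow> x + y \<in> laurent m"
| mult: "x \<in> laurent m \<Longrightarrow> y \<in> laurent m \<Longrightarrow> x * y \<in> laurent m"

inductive_set denominators :: "nat \<Rightarrow> nat \<Rightarrow> ratfun set" for m n :: nat where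
  one: "1 \<in> denominators m n"
| geometric: "1 \<le> N \<Longrightarrow> N \<le> n \<Longrightarrow> (\<Sum>i\<le>N. q ^ (2 * i)) \<in> denominators m n"
| difference: "1 \<le> j \<Longrightarrow> j \<le> m \<Longrightarrow> 1 \<le> k \<Longrightarrow> k \<le> m \<Longrightarrow> j \<noteq> k \<Longrightarrow> - int n < i \<Longrightarrow> i < int n \<Longrightarrow>
    q powi (2 * i) * v j - v k \<in> denominators m n"
| mult: "x \<in> denominators m n \<Longrightarrow> y \<in> denominators m n \<Longrightarrow> x * y \<in> denominators m n"

definition ground_ring :: "nat \<Rightarrow> nat \<Rightarrow> ratfun ring" where
  "ground_ring m n =
    \<lparr>carrier = {a / s | a s. a \<in> laurent m \<and> s \<in> denominators m n},
     mult = (*), one = 1, zero = 0, add = (+)\<rparr>"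

lemma cnst_0: "cnst 0 = 0"
  by (simp add: cnst_def Zero_fract_def)

lemma cnst_1: "cnst 1 = 1"
  by (simp only: cnst_def single_one One_fract_def)

lemma cnst_uminus: "cnst (- z) = - cnst z"
  by (simp only: cnst_def single_uminus minus_fract)

lemma laurent_0: "0 \<in> laurent m" and laurent_1: "1 \<in> laurent m"
  using laurent.cnst[of 0] laurent.cnst[of 1] by (simp_all add: cnst_0 cnst_1)

lemma laurent_uminus: "x \<in> laurent m \<Longrightarrow> - x \<in> laurent m"
  using laurent.mult[OF laurent.cnst[of "- 1"], of x] by (simp add: cnst_1 cnst_uminus)

lemma laurent_power: "x \<in> laurent m \<Longrightarrow> x ^ k \<in> laurent m"
  by (induction k) (auto intro: laurent_1 laurent.mult)

lemma laurent_sum: "(\<And>i. i \<in> A \<Longrightarrow> f i \<in> laurent m) \<Longrightarrow> sum f A \<in> laurent m"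
  by (induction A rule: infinite_finite_induct) (auto intro: laurent_0 laurent.add)

lemma denominators_laurent: "s \<in> denominators m n \<Longrightarrow> s \<in> laurent m"
proof (induction rule: denominators.induct)
  case (difference j k i)
  have "q powi (2 * i) \<in> laurent m"
    unfolding power_int_def
    by (simp add: laurent_power laurent.q laurent.q_inverse del: power_inverse)
  then have "q powi (2 * i) * v j + - v k \<in> laurent m"
    using difference by (intro laurent.add laurent.mult laurent_uminus laurent.v)
  then show ?case by simp
qed (auto intro: laurent_1 laurent.mult laurent_sum laurent_power laurent.q)

lemma ground_ring_cring: "cring (ground_ring m n)"
proof (rule cringI)
  have mem: "a / s \<in> carrier (ground_ring m n)" if "a \<in> laurent m" "s \<in> denominators m n" for a s
    using that by (auto simp: ground_ring_def)
  have ex: "\<exists>a s. x = a / s \<and> a \<in> laurent m \<and> s \<in> denominators m n"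
    if "x \<in> carrier (ground_ring m n)" for x
    using that by (auto simp: ground_ring_def)
  have zero: "0 \<in> carrier (ground_ring m n)" and one: "1 \<in> carrier (ground_ring m n)"
    using mem[OF laurent_0 denominators.one] mem[OF laurent_1 denominators.one] by simp_all
  have add: "x + y \<in> carrier (ground_ring m n)"
    if xy: "x \<in> carrier (ground_ring m n)" "y \<in> carrier (ground_ring m n)" for x y
  proof -
    obtain a s b t where *: "x = a / s" "a \<in> laurent m" "s \<in> denominators m n"
      "y = b / t" "b \<in> laurent m" "t \<in> denominators m n"
      using ex[OF xy(1)] ex[OF xy(2)] by blast
    show ?thesis
    proof (cases "s = 0 \<or> t = 0")
      case True
      then have "x = 0 \<or> y = 0" using *(1,4) by auto
      then show ?thesis using xy by auto
    next
      case False
      then have "x + y = (a * t + b * s) / (s * t)"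
        unfolding *(1,4) using False by (intro add_frac_eq) simp_all
      moreover have "(a * t + b * s) / (s * t) \<in> carrier (ground_ring m n)"
        by (intro mem laurent.add laurent.mult denominators.mult denominators_laurent[of _ m n] *)
      ultimately show ?thesis by metis
    qed
  qed
  have mult: "x * y \<in> carrier (ground_ring m n)"
    if xy: "x \<in> carrier (ground_ring m n)" "y \<in> carrier (ground_ring m n)" for x y
  proof -
    obtain a s b t where *: "x = a / s" "a \<in> laurent m" "s \<in> denominators m n"
      "y = b / t" "b \<in> laurent m" "t \<in> denominators m n"
      using ex[OF xy(1)] ex[OF xy(2)] by blast
    have "(a * b) / (s * t) \<in> carrier (ground_ring m n)"
      by (intro mem laurent.mult denominators.mult *)
    then show ?thesis unfolding *(1,4) by simp
  qed
  have neg: "- x \<in> carrier (ground_ring m n)" if x: "x \<in> carrier (ground_ring m n)" for x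
  proof -
    obtain a s where *: "x = a / s" "a \<in> laurent m" "s \<in> denominators m n"
      using ex[OF x] by blast
    have "(- a) / s \<in> carrier (ground_ring m n)"
      by (intro mem laurent_uminus *)
    then show ?thesis unfolding *(1) by simp
  qed
  show "abelian_group (ground_ring m n)"
  proof (rule abelian_groupI)
    fix x assume x: "x \<in> carrier (ground_ring m n)"
    show "\<exists>y\<in>carrier (ground_ring m n). y \<oplus>\<^bsub>ground_ring m n\<^esub> x = \<zero>\<^bsub>ground_ring m n\<^esub>"
      using neg[OF x] by (intro bexI[of _ "- x"]) (simp_all add: ground_ring_def)
  qed (use zero add in \<open>simp_all add: ground_ring_def ac_simps\<close>)
  show "comm_monoid (ground_ring m n)"
    by (rule comm_monoidI) (use one mult in \<open>simp_all add: ground_ring_def ac_simps\<close>)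
qed (simp add: ground_ring_def distrib_right)

lemma ground_ring_closed:
  "0 \<in> carrier (ground_ring m n)" "1 \<in> carrier (ground_ring m n)"
  "x \<in> carrier (ground_ring m n) \<Longrightarrow> y \<in> carrier (ground_ring m n) \<Longrightarrow> x + y \<in> carrier (ground_ring m n)"
  "x \<in> carrier (ground_ring m n) \<Longrightarrow> y \<in> carrier (ground_ring m n) \<Longrightarrow> x * y \<in> carrier (ground_ring m n)"
  using cring.cring_simprules(1,2,5,6)[OF ground_ring_cring[of m n]] by (simp_all add: ground_ring_def)

lemma laurent_subset_ground_ring: "x \<in> laurent m \<Longrightarrow> x \<in> carrier (ground_ring m n)"
  by (force simp: ground_ring_def intro: denominators.one)

lemma ground_ring_uminus:
  assumes "x \<in> carrier (ground_ring m n)" shows "- x \<in> carrier (ground_ring m n)"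
  using ground_ring_closed(4)[OF laurent_subset_ground_ring[OF laurent_uminus[OF laurent_1]] assms]
  by simp

lemma ground_ring_sum:
  "(\<And>i. i \<in> A \<Longrightarrow> f i \<in> carrier (ground_ring m n)) \<Longrightarrow> sum f A \<in> carrier (ground_ring m n)"
  by (induction A rule: infinite_finite_induct) (auto intro: ground_ring_closed)


section \<open>The algebra \<open>H(m,1,n)\<close>\<close>

datatype 'g word = Word (letters: "'g list")

instantiation word :: (type) monoid_add
begin
definition zero_word :: "'a word" where "0 = Word []"
definition plus_word :: "'a word \<Rightarrow> 'a word \<Rightarrow> 'a word" where
  "x + y = Word (letters x @ letters y)"
instance by standard (simp_all add: zero_word_def plus_word_def)
end

text \<open>The multiplication of \<open>'g word \<Rightarrow>\<^sub>0 ratfun\<close> is the convolution product, so this type is the free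
  associative algebra over the ambient field.\<close>

type_synonym 'g free_alg = "'g word \<Rightarrow>\<^sub>0 ratfun"

definition scal :: "ratfun \<Rightarrow> 'g free_alg" where
  "scal r = Poly_Mapping.single 0 r"

definition letter :: "'g \<Rightarrow> 'g free_alg" where
  "letter g = Poly_Mapping.single (Word [g]) 1"

definition free_algebra :: "(ratfun, 'b) ring_scheme \<Rightarrow> 'g set \<Rightarrow> 'g free_alg ring" where
  "free_algebra R G =
    \<lparr>carrier = {p. \<forall>w. Poly_Mapping.lookup p w \<in> carrier R \<and>
      (Poly_Mapping.lookup p w \<noteq> 0 \<longrightarrow> set (letters w) \<subseteq> G)},
     mult = (*), one = 1, zero = 0, add = (+)\<rparr>"

lemma free_algebra_ring: "ring (free_algebra (ground_ring m n) G)"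
proof -
  let ?C = "carrier (free_algebra (ground_ring m n) G)"
  have mem: "p \<in> ?C \<longleftrightarrow> (\<forall>w. Poly_Mapping.lookup p w \<in> carrier (ground_ring m n)) \<and>
      (\<forall>w\<in>Poly_Mapping.keys p. set (letters w) \<subseteq> G)" for p
    by (auto simp: free_algebra_def in_keys_iff)
  have zero: "0 \<in> ?C" and one: "1 \<in> ?C"
    by (auto simp: mem lookup_one when_def ground_ring_closed zero_word_def)
  have add_C: "x + y \<in> ?C" if "x \<in> ?C" "y \<in> ?C" for x y
    using that keys_add[of x y] unfolding mem lookup_add by (blast intro: ground_ring_closed)
  have neg: "- x \<in> ?C" if "x \<in> ?C" for x
    using that by (auto simp: mem ground_ring_uminus)
  have mult_C: "x * y \<in> ?C" if "x \<in> ?C" "y \<in> ?C" for x y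
  proof -
    have "Poly_Mapping.lookup (x * y) w \<in> carrier (ground_ring m n)" for w
      unfolding lookup_mult Sum_any.expand_set
      using that by (auto simp: mem when_def intro!: ground_ring_sum ground_ring_closed)
    moreover have "set (letters w) \<subseteq> G" if "w \<in> Poly_Mapping.keys (x * y)" for w
    proof -
      obtain a b where "w = a + b" "a \<in> Poly_Mapping.keys x" "b \<in> Poly_Mapping.keys y"
        using \<open>w \<in> Poly_Mapping.keys (x * y)\<close> keys_mult[of x y] by blast
      then show ?thesis
        using \<open>x \<in> ?C\<close> \<open>y \<in> ?C\<close> by (auto simp: mem plus_word_def)
    qed
    ultimately show ?thesis by (simp add: mem)
  qed
  have ops: "x \<oplus>\<^bsub>free_algebra (ground_ring m n) G\<^esub> y = x + y"
    "x \<otimes>\<^bsub>free_algebra (ground_ring m n) G\<^esub> y = x * y"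
    "\<zero>\<^bsub>free_algebra (ground_ring m n) G\<^esub> = 0" "\<one>\<^bsub>free_algebra (ground_ring m n) G\<^esub> = 1" for x y
    by (simp_all add: free_algebra_def)
  show ?thesis
  proof (rule ringI)
    show "abelian_group (free_algebra (ground_ring m n) G)"
    proof (rule abelian_groupI, unfold ops)
      show "\<exists>y\<in>?C. y + x = 0" if "x \<in> ?C" for x
        using neg[OF that] by (intro bexI[of _ "- x"]) simp_all
    qed (rule zero add_C add.assoc add.commute add_0_left; assumption?)+
    show "monoid (free_algebra (ground_ring m n) G)"
      by (rule monoidI, unfold ops) (rule one mult_C mult.assoc mult_1_left mult_1_right; assumption?)+
  qed (simp_all only: ops distrib_left distrib_right)
qed

lemma scal_closed:
  "r \<in> carrier (ground_ring m n) \<Longrightarrow> scal r \<in> carrier (free_algebra (ground_ring m n) G)"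
  by (auto simp: scal_def free_algebra_def lookup_single when_def zero_word_def ground_ring_closed)

lemma letter_closed:
  "g \<in> G \<Longrightarrow> letter g \<in> carrier (free_algebra (ground_ring m n) G)"
  by (auto simp: letter_def free_algebra_def lookup_single when_def ground_ring_closed)

datatype gen = Tau | Sigma nat

definition gens :: "nat \<Rightarrow> gen set" where
  "gens n = insert Tau (Sigma ` {1..<n})"

definition relators :: "nat \<Rightarrow> nat \<Rightarrow> gen free_alg set" where
  "relators m n =
    (let t = letter Tau; s = (\<lambda>i. letter (Sigma i)) in
      {s i * s (Suc i) * s i - s (Suc i) * s i * s (Suc i) | i. 1 \<le> i \<and> Suc i < n} \<union>
      {s i * s j - s j * s i | i j. i \<in> {1..<n} \<and> j \<in> {1..<n} \<and> \<bar>int i - int j\<bar> > 1} \<union>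
      (if 1 < n then {t * s 1 * t * s 1 - s 1 * t * s 1 * t} else {}) \<union>
      {t * s i - s i * t | i. 1 < i \<and> i < n} \<union>
      {s i * s i - (scal (q - inverse q) * s i + 1) | i. i \<in> {1..<n}} \<union>
      {prod_list (map (\<lambda>j. t - scal (v j)) [1..<Suc m])})"

abbreviation hecke_free :: "nat \<Rightarrow> nat \<Rightarrow> gen free_alg ring" where
  "hecke_free m n \<equiv> free_algebra (ground_ring m n) (gens n)"

abbreviation hecke_ideal :: "nat \<Rightarrow> nat \<Rightarrow> gen free_alg set" where
  "hecke_ideal m n \<equiv> Idl\<^bsub>hecke_free m n\<^esub> (relators m n)"

definition hecke :: "nat \<Rightarrow> nat \<Rightarrow> gen free_alg set ring" where
  "hecke m n = hecke_free m n Quot hecke_ideal m n"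

definition hecke_gen :: "nat \<Rightarrow> nat \<Rightarrow> gen \<Rightarrow> gen free_alg set" where
  "hecke_gen m n g = hecke_ideal m n +>\<^bsub>hecke_free m n\<^esub> letter g"

definition hecke_scal :: "nat \<Rightarrow> nat \<Rightarrow> ratfun \<Rightarrow> gen free_alg set" where
  "hecke_scal m n r = hecke_ideal m n +>\<^bsub>hecke_free m n\<^esub> scal r"

lemma relators_closed: "relators m n \<subseteq> carrier (hecke_free m n)"
proof -
  interpret ring "hecke_free m n" by (rule free_algebra_ring)
  have rec: "x + y = x \<oplus>\<^bsub>hecke_free m n\<^esub> y" "x * y = x \<otimes>\<^bsub>hecke_free m n\<^esub> y"
    "1 = \<one>\<^bsub>hecke_free m n\<^esub>" for x y :: "gen free_alg"
    by (simp_all add: free_algebra_def)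
  have add: "x + y \<in> carrier (hecke_free m n)" and mult: "x * y \<in> carrier (hecke_free m n)"
    if "x \<in> carrier (hecke_free m n)" "y \<in> carrier (hecke_free m n)" for x y
    using that unfolding rec by simp_all
  have one: "1 \<in> carrier (hecke_free m n)"
    unfolding rec by simp
  have diff: "x - y \<in> carrier (hecke_free m n)"
    if "x \<in> carrier (hecke_free m n)" "y \<in> carrier (hecke_free m n)" for x y
  proof -
    have "x - y = x + scal (- 1) * y"
      by (simp add: scal_def single_uminus)
    moreover have "scal (- 1) \<in> carrier (hecke_free m n)"
      by (intro scal_closed ground_ring_uminus ground_ring_closed)
    ultimately show ?thesis using that add mult by metis
  qed
  have t: "letter Tau \<in> carrier (hecke_free m n)"
    by (intro letter_closed) (simp add: gens_def)
  have s: "letter (Sigma i) \<in> carrier (hecke_free m n)" if "1 \<le> i" "i < n" for i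
    by (intro letter_closed) (use that in \<open>simp add: gens_def\<close>)
  have scq: "scal (q - inverse q) \<in> carrier (hecke_free m n)"
    using laurent.add[OF laurent.q laurent_uminus[OF laurent.q_inverse], of m]
    by (intro scal_closed laurent_subset_ground_ring) simp
  have scv: "scal (v j) \<in> carrier (hecke_free m n)" if "1 \<le> j" "j \<le> m" for j
    using that by (intro scal_closed laurent_subset_ground_ring laurent.v)
  have "prod_list xs \<in> carrier (hecke_free m n)" if "set xs \<subseteq> carrier (hecke_free m n)" for xs
    using that by (induction xs) (auto intro: one mult)
  moreover have "set (map (\<lambda>j. letter Tau - scal (v j)) [1..<Suc m]) \<subseteq> carrier (hecke_free m n)"
    using diff[OF t scv] by (auto simp del: upt_Suc)
  ultimately have "prod_list (map (\<lambda>j. letter Tau - scal (v j)) [1..<Suc m]) \<in> carrier (hecke_free m n)"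
    by blast
  then show ?thesis
    unfolding relators_def Let_def by (auto intro!: diff add mult t s scq one simp del: upt_Suc)
qed

lemma hecke_ring: "ring (hecke m n)"
  unfolding hecke_def
  by (intro ideal.quotient_is_ring ring.genideal_ideal free_algebra_ring relators_closed)


section \<open>Multipartitions and standard tableaux\<close>

definition is_partition :: "nat list \<Rightarrow> bool" where
  "is_partition p \<longleftrightarrow> sorted_wrt (\<ge>) p \<and> 0 \<notin> set p"

definition multipartition :: "nat \<Rightarrow> nat \<Rightarrow> nat list list \<Rightarrow> bool" where
  "multipartition m n lam \<longleftrightarrow>
    length lam = m \<and> (\<forall>p\<in>set lam. is_partition p) \<and> sum_list (map sum_list lam) = n"

text \<open>A node \<open>(k, r, s)\<close> lies in row \<open>r\<close> and column \<open>s\<close> of the \<open>k\<close>-th diagram; all three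
  coordinates start at 1.\<close>

type_synonym node = "nat \<times> nat \<times> nat"

definition nodes :: "nat list list \<Rightarrow> node set" where
  "nodes lam = {(k, r, s). 1 \<le> k \<and> k \<le> length lam \<and> 1 \<le> r \<and> r \<le> length (lam ! (k - 1)) \<and>
                           1 \<le> s \<and> s \<le> lam ! (k - 1) ! (r - 1)}"

fun node_content :: "node \<Rightarrow> ratfun" where
  "node_content (k, r, s) = v k * q powi (2 * (int s - int r))"

text \<open>A filling is normalised to be 0 outside the diagrams, so that distinct functions are distinct
  tableaux; exchanging two positive entries preserves this.\<close>

type_synonym tableau = "node \<Rightarrow> nat"

definition standard_tableaux :: "nat list list \<Rightarrow> tableau set" where
  "standard_tableaux lam = {X.
     bij_betw X (nodes lam) {1..sum_list (map sum_list lam)} \<and>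
     (\<forall>x. x \<notin> nodes lam \<longrightarrow> X x = 0) \<and>
     (\<forall>k r s s'. (k, r, s) \<in> nodes lam \<and> (k, r, s') \<in> nodes lam \<and> s < s' \<longrightarrow>
        X (k, r, s) < X (k, r, s')) \<and>
     (\<forall>k r r' s. (k, r, s) \<in> nodes lam \<and> (k, r', s) \<in> nodes lam \<and> r < r' \<longrightarrow>
        X (k, r, s) < X (k, r', s))}"

definition content :: "nat list list \<Rightarrow> tableau \<Rightarrow> nat \<Rightarrow> ratfun" where
  "content lam X i = node_content (the_inv_into (nodes lam) X i)"

definition swap_entries :: "nat \<Rightarrow> tableau \<Rightarrow> tableau" where
  "swap_entries i X = transpose i (Suc i) \<circ> X"


section \<open>The module and bilinear forms on it\<close>

text \<open>The free module on the finite set of standard tableaux, realised as coordinate functions.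
  The \<open>module\<close> record extends \<open>ring\<close>; its fields \<open>mult\<close> and \<open>one\<close> are irrelevant here.\<close>

definition tableau_module :: "nat \<Rightarrow> nat \<Rightarrow> nat list list \<Rightarrow> (ratfun, tableau \<Rightarrow> ratfun) module" where
  "tableau_module m n lam =
    \<lparr>carrier = {u. \<forall>X. u X \<in> carrier (ground_ring m n) \<and> (X \<notin> standard_tableaux lam \<longrightarrow> u X = 0)},
     mult = undefined, one = undefined,
     zero = (\<lambda>_. 0), add = (\<lambda>u w X. u X + w X), smult = (\<lambda>r u X. r * u X)\<rparr>"

text \<open>The basis vector of a standard tableau, and 0 for any other filling.\<close>

definition basis_vec :: "nat list list \<Rightarrow> tableau \<Rightarrow> tableau \<Rightarrow> ratfun" where
  "basis_vec lam X = (\<lambda>Y. if X \<in> standard_tableaux lam \<and> Y = X then 1 else 0)"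

lemma tableau_module_module: "module (ground_ring m n) (tableau_module m n lam)"
proof -
  have ops: "x \<oplus>\<^bsub>ground_ring m n\<^esub> y = x + y" "x \<otimes>\<^bsub>ground_ring m n\<^esub> y = x * y"
    "\<one>\<^bsub>ground_ring m n\<^esub> = 1" for x y
    by (simp_all add: ground_ring_def)
  have "abelian_group (tableau_module m n lam)"
  proof (rule abelian_groupI)
    fix x assume "x \<in> carrier (tableau_module m n lam)"
    then show "\<exists>y\<in>carrier (tableau_module m n lam).
        y \<oplus>\<^bsub>tableau_module m n lam\<^esub> x = \<zero>\<^bsub>tableau_module m n lam\<^esub>"
      by (intro bexI[of _ "\<lambda>X. - x X"]) (auto simp: tableau_module_def ground_ring_uminus)
  qed (simp_all add: tableau_module_def ground_ring_closed ac_simps)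
  then show ?thesis
    by (intro moduleI ground_ring_cring)
       (simp_all add: ops tableau_module_def ground_ring_closed distrib_left distrib_right mult.assoc)
qed

lemma basis_vec_closed: "basis_vec lam X \<in> carrier (tableau_module m n lam)"
  by (simp add: tableau_module_def basis_vec_def ground_ring_closed)

text \<open>Unital left modules over an \<open>R\<close>-algebra \<open>H\<close> with structure map \<open>sc\<close> from \<open>R\<close> to \<open>H\<close>, such that
  the scalar multiplication obtained through \<open>sc\<close> is the given one of the \<open>R\<close>-module \<open>U\<close>.\<close>

definition algebra_action ::
  "('r, 'x) ring_scheme \<Rightarrow> ('r \<Rightarrow> 'h) \<Rightarrow> ('h, 'y) ring_scheme \<Rightarrow> ('r, 'u, 'z) module_scheme \<Rightarrow>
    ('h \<Rightarrow> 'u \<Rightarrow> 'u) \<Rightarrow> bool" where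
  "algebra_action R sc H U act \<longleftrightarrow>
    (\<forall>h\<in>carrier H. \<forall>u\<in>carrier U. act h u \<in> carrier U) \<and>
    (\<forall>h\<in>carrier H. \<forall>u\<in>carrier U. \<forall>w\<in>carrier U. act h (u \<oplus>\<^bsub>U\<^esub> w) = act h u \<oplus>\<^bsub>U\<^esub> act h w) \<and>
    (\<forall>h\<in>carrier H. \<forall>g\<in>carrier H. \<forall>u\<in>carrier U. act (h \<oplus>\<^bsub>H\<^esub> g) u = act h u \<oplus>\<^bsub>U\<^esub> act g u) \<and>
    (\<forall>h\<in>carrier H. \<forall>g\<in>carrier H. \<forall>u\<in>carrier U. act (h \<otimes>\<^bsub>H\<^esub> g) u = act h (act g u)) \<and>
    (\<forall>u\<in>carrier U. act \<one>\<^bsub>H\<^esub> u = u) \<and>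
    (\<forall>r\<in>carrier R. \<forall>u\<in>carrier U. act (sc r) u = r \<odot>\<^bsub>U\<^esub> u)"

text \<open>The action is determined by the values on generators and basis vectors.\<close>

definition tableau_action ::
  "nat \<Rightarrow> nat \<Rightarrow> nat list list \<Rightarrow>
    (gen free_alg set \<Rightarrow> (tableau \<Rightarrow> ratfun) \<Rightarrow> (tableau \<Rightarrow> ratfun)) \<Rightarrow> bool" where
  "tableau_action m n lam act \<longleftrightarrow>
    algebra_action (ground_ring m n) (hecke_scal m n) (hecke m n) (tableau_module m n lam) act \<and>
    (\<forall>X\<in>standard_tableaux lam.
      let U = tableau_module m n lam; c = content lam X in
      act (hecke_gen m n Tau) (basis_vec lam X) = c 1 \<odot>\<^bsub>U\<^esub> basis_vec lam X \<and>
      (\<forall>i\<in>{1..<n}.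
        act (hecke_gen m n (Sigma i)) (basis_vec lam X) =
          ((q - inverse q) * c (Suc i) / (c (Suc i) - c i)) \<odot>\<^bsub>U\<^esub> basis_vec lam X \<oplus>\<^bsub>U\<^esub>
          ((q * c (Suc i) - inverse q * c i) / (c (Suc i) - c i)) \<odot>\<^bsub>U\<^esub>
            basis_vec lam (swap_entries i X)))"

definition bilinear_form ::
  "('r, 'x) ring_scheme \<Rightarrow> ('r, 'u, 'z) module_scheme \<Rightarrow> ('u \<Rightarrow> 'u \<Rightarrow> 'r) \<Rightarrow> bool" where
  "bilinear_form R U B \<longleftrightarrow>
    (\<forall>u\<in>carrier U. \<forall>w\<in>carrier U. B u w \<in> carrier R) \<and>
    (\<forall>u\<in>carrier U. \<forall>u'\<in>carrier U. \<forall>w\<in>carrier U.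
      B (u \<oplus>\<^bsub>U\<^esub> u') w = B u w \<oplus>\<^bsub>R\<^esub> B u' w \<and> B w (u \<oplus>\<^bsub>U\<^esub> u') = B w u \<oplus>\<^bsub>R\<^esub> B w u') \<and>
    (\<forall>r\<in>carrier R. \<forall>u\<in>carrier U. \<forall>w\<in>carrier U.
      B (r \<odot>\<^bsub>U\<^esub> u) w = r \<otimes>\<^bsub>R\<^esub> B u w \<and> B u (r \<odot>\<^bsub>U\<^esub> w) = r \<otimes>\<^bsub>R\<^esub> B u w)"

definition tableau_norm :: "nat \<Rightarrow> nat list list \<Rightarrow> tableau \<Rightarrow> ratfun" where
  "tableau_norm n lam X =
    (let c = content lam X in
      \<Prod>(j, k) | 1 \<le> j \<and> j < k \<and> k \<le> n \<and> c j \<noteq> c k \<and>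
                 c j \<noteq> c k * q powi 2 \<and> c j \<noteq> c k * q powi (-2).
        (inverse q * c j - q * c k) / (c j - c k))"

definition tableau_form ::
  "nat \<Rightarrow> nat \<Rightarrow> nat list list \<Rightarrow> ((tableau \<Rightarrow> ratfun) \<Rightarrow> (tableau \<Rightarrow> ratfun) \<Rightarrow> ratfun) \<Rightarrow> bool" where
  "tableau_form m n lam B \<longleftrightarrow>
    bilinear_form (ground_ring m n) (tableau_module m n lam) B \<and>
    (\<forall>X\<in>standard_tableaux lam. \<forall>Y\<in>standard_tableaux lam.
      B (basis_vec lam X) (basis_vec lam Y) = (if X = Y then tableau_norm n lam X else 0))"

text \<open>\<open>S\<^sup>-\<close>-invariance of a form, for a set \<open>S\<close> of invertible elements of \<open>H\<close>.\<close>

definition minus_invariant ::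
  "('h, 'y) ring_scheme \<Rightarrow> ('h \<Rightarrow> 'u \<Rightarrow> 'u) \<Rightarrow> 'h set \<Rightarrow> ('r, 'u, 'z) module_scheme \<Rightarrow>
    ('u \<Rightarrow> 'u \<Rightarrow> 'r) \<Rightarrow> bool" where
  "minus_invariant H act S U B \<longleftrightarrow>
    (\<forall>a\<in>S. \<forall>u\<in>carrier U. \<forall>w\<in>carrier U. B (act a u) (act (inv\<^bsub>H\<^esub> a) w) = B u w)"

end

theory Submission
  imports Defs
begin

text \<open>
  The generators are units of the algebra, so invariance amounts to their being self-adjoint for the
  form.  For \<open>\<tau>\<close> this is clear, since it is diagonal.  The matrix of \<open>\<sigma>\<^sub>i\<close> links a tableau only to the
  one with \<open>i\<close> and \<open>i + 1\<close> exchanged.  If both are standard, the nodes of \<open>i\<close> and \<open>i + 1\<close> are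
  incomparable, so the pair \<open>(i, i + 1)\<close> contributes to both norms; its factor is the off-diagonal
  matrix entry, and the remaining factors of the two norms coincide.
\<close>

section \<open>Scalars\<close>

lemma v_nonzero: "v j \<noteq> 0"
  by (simp add: v_def indet_def Zero_fract_def eq_fract flip: keys_eq_empty)

lemma q_nonzero: "q \<noteq> 0"
  by (simp add: q_def indet_def Zero_fract_def eq_fract flip: keys_eq_empty)

lemma q_power_v:
  "q ^ k * v j = Fract (Poly_Mapping.single (Poly_Mapping.single 0 k + Poly_Mapping.single j 1) 1) 1"
proof (induction k)
  case 0
  then show ?case by (simp add: v_def indet_def)
next
  case (Suc k)
  have "Poly_Mapping.single 0 1 + Poly_Mapping.single 0 k = Poly_Mapping.single (0::nat) (Suc k)"
    by (simp flip: single_add)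
  moreover have "q ^ Suc k * v j = q * (q ^ k * v j)"
    by (simp add: mult.assoc)
  ultimately show ?case
    unfolding Suc.IH by (simp add: q_def indet_def mult_single flip: add.assoc)
qed

text \<open>Distinct exponent vectors give distinct monomials. The indices start at 1, which keeps
  \<open>v j\<close> apart from \<open>q\<close>, the variable with index 0.\<close>

lemma q_power_v_inject:
  assumes "j \<ge> 1" "j' \<ge> 1" "q ^ k * v j = q ^ k' * v j'"
  shows "j = j' \<and> k = k'"
proof -
  let ?e = "\<lambda>k j. Poly_Mapping.single 0 k + Poly_Mapping.single j (1::nat)"
  have "Poly_Mapping.single (?e k j) (1::complex) = Poly_Mapping.single (?e k' j') 1"
    using assms(3) unfolding q_power_v by (simp add: eq_fract)
  then have e: "?e k j = ?e k' j'"
    by (metis keys_single one_neq_zero singleton_inject)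
  have "Poly_Mapping.lookup (?e k j) 0 = k" "Poly_Mapping.lookup (?e k' j') 0 = k'"
    using assms(1,2) by (auto simp: lookup_add lookup_single when_def)
  moreover have "Poly_Mapping.lookup (?e k j) j = 1"
    using assms(1) by (auto simp: lookup_add lookup_single when_def)
  then have "Poly_Mapping.lookup (?e k' j') j = 1"
    by (simp only: e)
  then have "j = j'"
    using assms(1) by (auto simp: lookup_add lookup_single when_def split: if_splits)
  ultimately show ?thesis using e by metis
qed

lemma q_powi_v_inject:
  assumes "j \<ge> 1" "j' \<ge> 1" "v j * q powi x = v j' * q powi y"
  shows "j = j' \<and> x = y"
proof -
  \<comment> \<open>Multiplying both sides by \<open>q powi K\<close> makes the two exponents
    nonnegative, so the statement for natural powers applies.\<close>
  define K where "K = \<bar>x\<bar> + \<bar>y\<bar>"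
  have "q ^ nat (x + K) * v j = q powi (x + K) * v j" "q ^ nat (y + K) * v j' = q powi (y + K) * v j'"
    by (simp_all add: K_def power_int_def)
  moreover have "q powi (x + K) * v j = q powi (y + K) * v j'"
    using assms(3) by (simp add: power_int_add q_nonzero ac_simps)
  ultimately have "j = j' \<and> nat (x + K) = nat (y + K)"
    using q_power_v_inject[OF assms(1,2)] by metis
  then show ?thesis by (auto simp: K_def)
qed

section \<open>Norm factors in the ground ring\<close>

lemma laurent_q_powi: "q powi k \<in> laurent m"
  unfolding power_int_def by (simp add: laurent_power laurent.q laurent.q_inverse del: power_inverse)

lemma laurent_diff: "x \<in> laurent m \<Longrightarrow> y \<in> laurent m \<Longrightarrow> x - y \<in> laurent m"
  using laurent.add[OF _ laurent_uminus] by fastforce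

lemma ground_ring_divide:
  "a \<in> laurent m \<Longrightarrow> s \<in> denominators m n \<Longrightarrow> a / s \<in> carrier (ground_ring m n)"
  by (auto simp: ground_ring_def)

lemma geometric_in_denominators: "e \<le> n \<Longrightarrow> (\<Sum>i<Suc e. q ^ (2 * i)) \<in> denominators m n"
  unfolding lessThan_Suc_atMost
  by (cases "e = 0") (auto intro: denominators.one denominators.geometric)

text \<open>The factor \<open>q\<^sup>2 - 1\<close> is not among the listed generators of the
  denominators. Splitting it off lets it cancel from norm factors, leaving geometric sums that
  are.\<close>

lemma q_geometric_sum: "q ^ (2 * k) - 1 = (q\<^sup>2 - 1) * (\<Sum>i<k. q ^ (2 * i))"
  using power_diff_1_eq[of "q\<^sup>2" k] by (simp add: power_mult)

text \<open>Within one diagram the parameter \<open>v j\<close> cancels, and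
  \<open>q powi (2 * d)\<close> is the ratio of the two contents. Up to a unit, numerator and
  denominator are then of the form \<open>q ^ (2 * k) - 1\<close>; after cancelling
  \<open>q\<^sup>2 - 1\<close> the denominator is a geometric sum short enough to be
  admissible.\<close>

lemma norm_factor_same_diagram:
  assumes "\<bar>d\<bar> < int n" "q powi (2 * d) \<noteq> 1"
  shows "(inverse q * q powi (2 * d) - q) / (q powi (2 * d) - 1) \<in> carrier (ground_ring m n)"
proof -
  have d0: "d \<noteq> 0" using assms(2) by auto
  note q_nonzero [simp]
  show ?thesis
  proof (cases "d > 0")
    case True
    then obtain e where d: "d = int (Suc e)"
      using pos_int_cases by (metis Suc_pred of_nat_0_less_iff)
    have qd: "q powi (2 * d) = q ^ (2 * Suc e)"
      unfolding d by (metis of_nat_mult of_nat_numeral power_int_of_nat)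
    have "q ^ (2 * Suc e) - 1 \<noteq> 0" using assms(2) unfolding qd by simp
    \<comment> \<open>This is where the hypothesis \<open>q powi (2 * d) \<noteq> 1\<close> enters:
      \<open>q\<^sup>2 - 1\<close> divides a nonzero element.\<close>
    then have nz: "q\<^sup>2 - 1 \<noteq> 0" unfolding q_geometric_sum by auto
    have "inverse q * q ^ (2 * Suc e) - q = q * (q ^ (2 * e) - 1)"
      by (simp add: power2_eq_square algebra_simps)
    also have "\<dots> = (q\<^sup>2 - 1) * (q * (\<Sum>i<e. q ^ (2 * i)))"
      unfolding q_geometric_sum by (simp only: ac_simps)
    finally have "(inverse q * q powi (2 * d) - q) / (q powi (2 * d) - 1) =
        (q * (\<Sum>i<e. q ^ (2 * i))) / (\<Sum>i<Suc e. q ^ (2 * i))"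
      unfolding qd q_geometric_sum using nz by (simp only: nonzero_mult_divide_mult_cancel_left not_False_eq_True)
    also have "\<dots> \<in> carrier (ground_ring m n)"
      using assms(1) d
      by (intro ground_ring_divide geometric_in_denominators laurent.mult laurent.q laurent_sum laurent_power)
         auto
    finally show ?thesis .
  next
    case False
    with d0 obtain e where "- d = int (Suc e)"
      using pos_int_cases[of "- d"] by (metis Suc_pred of_nat_0_less_iff neg_0_less_iff_less linorder_neqE)
    then have d: "d = - int (Suc e)" by simp
    let ?Q = "q ^ (2 * Suc e)"
    have qd: "q powi (2 * d) = inverse ?Q"
      unfolding d by (metis of_nat_mult of_nat_numeral power_int_of_nat power_int_minus mult_minus_right)
    have Q0: "?Q \<noteq> 0" by simp
    have "?Q - 1 \<noteq> 0" using assms(2) unfolding qd by (metis inverse_1 right_minus_eq)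
    then have nz: "q\<^sup>2 - 1 \<noteq> 0" unfolding q_geometric_sum by auto
    \<comment> \<open>Expanding the fraction by \<open>?Q\<close> clears the negative power of
      \<open>q\<close>.\<close>
    have "(inverse q * q powi (2 * d) - q) / (q powi (2 * d) - 1) =
        (?Q * (inverse q * inverse ?Q - q)) / (?Q * (inverse ?Q - 1))"
      unfolding qd using Q0 by (simp only: nonzero_mult_divide_mult_cancel_left not_False_eq_True)
    also have "?Q * (inverse q * inverse ?Q - q) = - (inverse q) * (q ^ (2 * Suc (Suc e)) - 1)"
      by (simp add: field_simps power2_eq_square)
    also have "?Q * (inverse ?Q - 1) = - (q ^ (2 * Suc e) - 1)"
      using Q0 by (simp add: algebra_simps)
    also have "- inverse q * (q ^ (2 * Suc (Suc e)) - 1) / - (q ^ (2 * Suc e) - 1) =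
        ((q\<^sup>2 - 1) * (inverse q * (\<Sum>i<Suc (Suc e). q ^ (2 * i)))) /
        ((q\<^sup>2 - 1) * (\<Sum>i<Suc e. q ^ (2 * i)))"
      unfolding q_geometric_sum by (simp only: mult_minus_left minus_divide_divide ac_simps)
    also have "\<dots> = (inverse q * (\<Sum>i<Suc (Suc e). q ^ (2 * i))) / (\<Sum>i<Suc e. q ^ (2 * i))"
      using nz by (simp only: nonzero_mult_divide_mult_cancel_left not_False_eq_True)
    also have "\<dots> \<in> carrier (ground_ring m n)"
      using assms(1) d
      by (intro ground_ring_divide geometric_in_denominators laurent.mult laurent.q_inverse laurent.q
          laurent_sum laurent_power) auto
    finally show ?thesis .
  qed
qed

text \<open>For different diagrams, a power of \<open>q\<close> turns the denominator into one of
  the inverted differences, and the bound on \<open>x - y\<close> is exactly the range allowed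
  there. For equal diagrams, dividing by the second content reduces to the previous lemma.\<close>

lemma norm_factor_closed:
  assumes j: "1 \<le> j" "j \<le> m" and k: "1 \<le> k" "k \<le> m"
    and xy: "\<bar>x - y\<bar> < int n"
    and ne: "v j * q powi (2 * x) \<noteq> v k * q powi (2 * y)"
  shows "(inverse q * (v j * q powi (2 * x)) - q * (v k * q powi (2 * y))) /
    (v j * q powi (2 * x) - v k * q powi (2 * y)) \<in> carrier (ground_ring m n)"
    (is "?a / ?b \<in> _")
proof (cases "j = k")
  case False
  let ?Y = "q powi (- 2 * y)"
  have "?a / ?b = (?Y * ?a) / (?Y * ?b)"
    by (simp add: q_nonzero)
  also have "?Y * ?b = q powi (2 * (x - y)) * v j - v k"
  proof -
    have "?Y * q powi (2 * x) = q powi (2 * (x - y))" "?Y * q powi (2 * y) = 1"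
      by (simp_all add: q_nonzero algebra_simps flip: power_int_add)
    then show ?thesis by (simp add: algebra_simps flip: mult.assoc)
  qed
  also have "?Y * ?a / \<dots> \<in> carrier (ground_ring m n)"
    using False j k xy
    by (intro ground_ring_divide laurent.mult laurent_diff laurent_q_powi laurent.q laurent.q_inverse
        laurent.v denominators.difference) auto
  finally show ?thesis .
next
  case True
  let ?Z = "v j * q powi (2 * y)" and ?D = "q powi (2 * (x - y))"
  have x: "v j * q powi (2 * x) = ?Z * ?D"
    by (simp add: q_nonzero algebra_simps flip: power_int_add)
  have Z: "?Z \<noteq> 0" by (simp add: v_nonzero q_nonzero)
  have "?a / ?b = (?Z * (inverse q * ?D - q)) / (?Z * (?D - 1))"
    unfolding x using True by (simp add: algebra_simps)
  also have "\<dots> = (inverse q * ?D - q) / (?D - 1)"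
    using Z by (simp only: nonzero_mult_divide_mult_cancel_left not_False_eq_True)
  also have "\<dots> \<in> carrier (ground_ring m n)"
    using ne x True by (intro norm_factor_same_diagram xy) auto
  finally show ?thesis .
qed

section \<open>Nodes and standard tableaux\<close>

lemma sum_list_ge_nth_add_length:
  assumes "0 \<notin> set p" "i < length p"
  shows "p ! i + length p \<le> Suc (sum_list (p::nat list))"
proof -
  \<comment> \<open>All parts are at least 1, so the parts before and after position
    \<open>i\<close> add up to at least their number.\<close>
  have "length xs \<le> sum_list xs" if "0 \<notin> set xs" for xs :: "nat list"
    using that by (induction xs) (auto simp: Suc_le_eq)
  from this[of "take i p"] this[of "drop (Suc i) p"] assms
  have "i \<le> sum_list (take i p)" "length p - Suc i \<le> sum_list (drop (Suc i) p)"
    using in_set_takeD[of 0 i p] in_set_dropD[of 0 "Suc i" p] by (auto simp: min_def split: if_splits)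
  moreover have "sum_list p = sum_list (take i p) + p ! i + sum_list (drop (Suc i) p)"
    using id_take_nth_drop[OF assms(2)] by (metis add.assoc sum_list.Cons sum_list.append)
  ultimately show ?thesis using assms(2) by linarith
qed

lemma finite_nodes: "finite (nodes lam)"
proof -
  have "nodes lam \<subseteq> (\<Union>k\<in>{1..length lam}. \<Union>r\<in>{1..length (lam ! (k - 1))}.
      (\<lambda>s. (k, r, s)) ` {1..lam ! (k - 1) ! (r - 1)})"
    by (force simp: nodes_def)
  then show ?thesis by (rule finite_subset) auto
qed

text \<open>The row of one node is at most the number of parts, and the column of the other is at
  most some part; both fit into one hook of the diagram. Mixing two nodes is what a difference of
  contents requires.\<close>

lemma node_hook_bound:
  assumes "multipartition m n lam" "(k, r, s) \<in> nodes lam" "(k, r', s') \<in> nodes lam"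
  shows "r + s' \<le> Suc (sum_list (lam ! (k - 1)))"
proof -
  let ?p = "lam ! (k - 1)"
  have "?p \<in> set lam" using assms(2) by (auto simp: nodes_def)
  then have "0 \<notin> set ?p" using assms(1) by (auto simp: multipartition_def is_partition_def)
  moreover have "r' - 1 < length ?p" using assms(3) by (auto simp: nodes_def)
  ultimately have "?p ! (r' - 1) + length ?p \<le> Suc (sum_list ?p)"
    by (rule sum_list_ge_nth_add_length)
  then show ?thesis
    using assms(2,3) by (auto simp: nodes_def)
qed

text \<open>In one diagram the difference equals \<open>(s + r') - (r + s')\<close>, where each
  bracket lies between 2 and \<open>n + 1\<close>. In different diagrams
  \<open>\<bar>s - r\<bar>\<close> is smaller than the size of its own diagram, and the two sizes
  add up to at most \<open>n\<close>.\<close>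

lemma node_content_distance:
  assumes lam: "multipartition m n lam"
    and x: "(k, r, s) \<in> nodes lam" and y: "(k', r', s') \<in> nodes lam"
  shows "\<bar>(int s - int r) - (int s' - int r')\<bar> < int n"
proof -
  let ?f = "\<lambda>i. sum_list (lam ! i)"
  have n: "n = (\<Sum>i<length lam. ?f i)"
    using lam by (auto simp: multipartition_def sum_list_sum_nth atLeast0LessThan)
  have pos: "1 \<le> r" "1 \<le> s" "1 \<le> r'" "1 \<le> s'" and kk: "1 \<le> k" "1 \<le> k'"
    and k: "k - 1 < length lam" "k' - 1 < length lam"
    using x y by (auto simp: nodes_def)
  show ?thesis
  proof (cases "k = k'")
    case True
    have "?f (k - 1) \<le> n"
      unfolding n using k by (intro member_le_sum) auto
    then show ?thesis
      using node_hook_bound[OF lam x, of r' s'] node_hook_bound[OF lam y, of r s] x y True pos by auto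
  next
    case False
    then have "k - 1 \<noteq> k' - 1" using kk by auto
    then have "?f (k - 1) + ?f (k' - 1) = sum ?f {k - 1, k' - 1}" by simp
    also have "\<dots> \<le> n" unfolding n using k by (intro sum_mono2) auto
    finally show ?thesis
      using node_hook_bound[OF lam x x] node_hook_bound[OF lam y y] pos by auto
  qed
qed

lemma nodes_corner:
  assumes "multipartition m n lam" "(k, r', s') \<in> nodes lam" "1 \<le> r" "r \<le> r'" "1 \<le> s" "s \<le> s'"
  shows "(k, r, s) \<in> nodes lam"
proof -
  let ?p = "lam ! (k - 1)"
  have "?p \<in> set lam" using assms(2) by (auto simp: nodes_def)
  then have "sorted_wrt (\<ge>) ?p"
    using assms(1) by (auto simp: multipartition_def is_partition_def)
  moreover have "r' - 1 < length ?p" using assms by (auto simp: nodes_def)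
  ultimately have "?p ! (r' - 1) \<le> ?p ! (r - 1)"
    using assms(3,4) by (cases "r = r'") (auto simp: sorted_wrt_iff_nth_less)
  then show ?thesis using assms by (auto simp: nodes_def)
qed

section \<open>Standard tableaux and integrality of their norms\<close>

lemma finite_standard_tableaux: "finite (standard_tableaux lam)"
proof (rule finite_subset)
  let ?n = "sum_list (map sum_list lam)"
  show "standard_tableaux lam \<subseteq>
      {f. \<forall>x. (x \<in> nodes lam \<longrightarrow> f x \<in> {1..?n}) \<and> (x \<notin> nodes lam \<longrightarrow> f x = 0)}"
    by (auto simp: standard_tableaux_def bij_betw_def)
  show "finite \<dots>"
    by (rule finite_set_of_finite_funs[OF finite_nodes finite_atLeastAtMost])
qed

lemma standard_tableaux_bij:
  assumes "multipartition m n lam" "X \<in> standard_tableaux lam"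
  shows "bij_betw X (nodes lam) {1..n}"
  using assms by (auto simp: standard_tableaux_def multipartition_def)

lemma standard_tableaux_row:
  "X \<in> standard_tableaux lam \<Longrightarrow> (k, r, s) \<in> nodes lam \<Longrightarrow> (k, r, s') \<in> nodes lam \<Longrightarrow> s < s' \<Longrightarrow>
    X (k, r, s) < X (k, r, s')"
  unfolding standard_tableaux_def by blast

lemma standard_tableaux_column:
  "X \<in> standard_tableaux lam \<Longrightarrow> (k, r, s) \<in> nodes lam \<Longrightarrow> (k, r', s) \<in> nodes lam \<Longrightarrow> r < r' \<Longrightarrow>
    X (k, r, s) < X (k, r', s)"
  unfolding standard_tableaux_def by blast

lemma node_of_entry:
  assumes "multipartition m n lam" "X \<in> standard_tableaux lam" "1 \<le> i" "i \<le> n"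
  obtains k r s where "(k, r, s) \<in> nodes lam" "X (k, r, s) = i"
    "content lam X i = v k * q powi (2 * (int s - int r))"
proof -
  have bij: "bij_betw X (nodes lam) {1..n}" by (rule standard_tableaux_bij[OF assms(1,2)])
  then obtain x where x: "x \<in> nodes lam" "X x = i"
    using assms(3,4) unfolding bij_betw_def by (metis atLeastAtMost_iff imageE)
  obtain k r s where xe: "x = (k, r, s)" by (metis prod.exhaust)
  have "the_inv_into (nodes lam) X i = x"
    using bij x by (auto simp: bij_betw_def intro!: the_inv_into_f_eq)
  then show ?thesis using that[of k r s] x xe by (simp add: content_def)
qed

text \<open>The distance bound for contents brings every factor under
  \<open>norm_factor_closed\<close>. This makes the form take values in the ground ring.\<close>

lemma tableau_norm_closed:
  assumes lam: "multipartition m n lam" and X: "X \<in> standard_tableaux lam"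
  shows "tableau_norm n lam X \<in> carrier (ground_ring m n)"
proof -
  have prod: "prod f A \<in> carrier (ground_ring m n)"
    if "\<And>a. a \<in> A \<Longrightarrow> f a \<in> carrier (ground_ring m n)" for f :: "nat \<times> nat \<Rightarrow> ratfun" and A
    using that by (induction A rule: infinite_finite_induct) (auto intro: ground_ring_closed)
  show ?thesis
    unfolding tableau_norm_def Let_def
  proof (rule prod, clarify)
    fix a b assume ab: "1 \<le> a" "a < b" "b \<le> n" "content lam X a \<noteq> content lam X b"
    obtain j r s where 1: "(j, r, s) \<in> nodes lam"
      "content lam X a = v j * q powi (2 * (int s - int r))"
      by (rule node_of_entry[OF lam X, of a]) (use ab in auto)
    obtain k r' s' where 2: "(k, r', s') \<in> nodes lam"
      "content lam X b = v k * q powi (2 * (int s' - int r'))"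
      by (rule node_of_entry[OF lam X, of b]) (use ab in auto)
    have "1 \<le> j" "j \<le> m" "1 \<le> k" "k \<le> m"
      using 1(1) 2(1) lam by (auto simp: nodes_def multipartition_def)
    then show "(inverse q * content lam X a - q * content lam X b) /
        (content lam X a - content lam X b) \<in> carrier (ground_ring m n)"
      using ab(4) unfolding 1(2) 2(2)
      by (intro norm_factor_closed node_content_distance[OF lam 1(1) 2(1)])
  qed
qed

section \<open>Exchanging neighbouring entries\<close>

lemma swap_entries_involutory: "swap_entries i (swap_entries i X) = X"
  by (simp add: swap_entries_def fun_eq_iff)

text \<open>Entries \<open>i\<close>, \<open>i + 1\<close> in comparable nodes would either occupy a common row or column, where they
  cannot be exchanged, or enclose a corner node whose entry lies strictly between them.\<close>

lemma swappable_nodes_incomparable: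
  assumes lam: "multipartition m n lam"
    and X: "X \<in> standard_tableaux lam" and Y: "swap_entries i X \<in> standard_tableaux lam"
    and x: "(k, r, s) \<in> nodes lam" and y: "(k, r', s') \<in> nodes lam"
    and X_xy: "{X (k, r, s), X (k, r', s')} = {i, Suc i}"
    and le: "r \<le> r'" "s \<le> s'"
  shows False
proof -
  have pos: "1 \<le> r" "1 \<le> s" using x by (auto simp: nodes_def)
  consider "r = r'" "s = s'" | "r = r'" "s < s'" | "r < r'" "s = s'" | "r < r'" "s < s'"
    using le by linarith
  then show False
  proof cases
    case 1
    then show False using X_xy by (auto simp: doubleton_eq_iff)
  next
    case 2
    then show False
      using standard_tableaux_row[OF X x] standard_tableaux_row[OF Y x] y X_xy
      by (fastforce simp: swap_entries_def doubleton_eq_iff)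
  next
    case 3
    then show False
      using standard_tableaux_column[OF X x] standard_tableaux_column[OF Y x] y X_xy
      by (fastforce simp: swap_entries_def doubleton_eq_iff)
  next
    case 4
    have z: "(k, r, s') \<in> nodes lam"
      by (rule nodes_corner[OF lam y]) (use pos le in auto)
    have "X (k, r, s) < X (k, r, s')" "X (k, r, s') < X (k, r', s')"
      using standard_tableaux_row[OF X x z] standard_tableaux_column[OF X z y] 4 by auto
    then show False using X_xy by (auto simp: doubleton_eq_iff)
  qed
qed

text \<open>The values 0, 1, -1 of \<open>d\<close> are the three coincidences of contents excluded
  from the norm. Each would put the two nodes into one diagram, on equal or adjacent diagonals, and
  such nodes are comparable.\<close>

lemma swappable_contents:
  assumes lam: "multipartition m n lam"
    and X: "X \<in> standard_tableaux lam" and Y: "swap_entries i X \<in> standard_tableaux lam"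
    and i: "1 \<le> i" "i < n" and d: "\<bar>d\<bar> \<le> 1"
  shows "content lam X i \<noteq> content lam X (Suc i) * q powi (2 * d)"
proof
  assume eq: "content lam X i = content lam X (Suc i) * q powi (2 * d)"
  obtain k r s where 1: "(k, r, s) \<in> nodes lam" "X (k, r, s) = i"
    "content lam X i = v k * q powi (2 * (int s - int r))"
    by (rule node_of_entry[OF lam X, of i]) (use i in auto)
  obtain k' r' s' where 2: "(k', r', s') \<in> nodes lam" "X (k', r', s') = Suc i"
    "content lam X (Suc i) = v k' * q powi (2 * (int s' - int r'))"
    by (rule node_of_entry[OF lam X, of "Suc i"]) (use i in auto)
  have "1 \<le> k" "1 \<le> k'" using 1(1) 2(1) by (auto simp: nodes_def)
  moreover have "v k * q powi (2 * (int s - int r)) = v k' * q powi (2 * (int s' - int r') + 2 * d)"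
    using eq unfolding 1(3) 2(3) by (simp add: power_int_add q_nonzero mult.assoc)
  ultimately have k: "k = k'" and "2 * (int s - int r) = 2 * (int s' - int r') + 2 * d"
    using q_powi_v_inject by blast+
  \<comment> \<open>For incomparable nodes the values of column minus row differ by at least
    2.\<close>
  then have "r \<le> r' \<and> s \<le> s' \<or> r' \<le> r \<and> s' \<le> s"
    using d by arith
  then show False
    using swappable_nodes_incomparable[OF lam X Y 1(1) 2(1)[folded k]]
      swappable_nodes_incomparable[OF lam X Y 2(1)[folded k] 1(1)] 1(2) 2(2) k
    by (auto simp: insert_commute)
qed

lemma content_swap_entries:
  assumes lam: "multipartition m n lam"
    and X: "X \<in> standard_tableaux lam" and Y: "swap_entries i X \<in> standard_tableaux lam"
    and i: "1 \<le> i" "i < n" and j: "1 \<le> j" "j \<le> n"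
  shows "content lam (swap_entries i X) j = content lam X (transpose i (Suc i) j)"
proof -
  have bij: "bij_betw X (nodes lam) {1..n}" by (rule standard_tableaux_bij[OF lam X])
  have bij': "bij_betw (swap_entries i X) (nodes lam) {1..n}" by (rule standard_tableaux_bij[OF lam Y])
  have "transpose i (Suc i) j \<in> {1..n}"
    using i j by (auto simp: transpose_def)
  then obtain x where x: "x \<in> nodes lam" "X x = transpose i (Suc i) j"
    using bij unfolding bij_betw_def by (metis imageE)
  then have "swap_entries i X x = j" by (simp add: swap_entries_def)
  then show ?thesis
    using bij bij' x by (simp add: content_def bij_betw_def the_inv_into_f_eq)
qed

text \<open>This is the off-diagonal matrix entry of \<open>Sigma i\<close>.\<close>

definition swap_coeff :: "nat list list \<Rightarrow> tableau \<Rightarrow> nat \<Rightarrow> ratfun" where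
  "swap_coeff lam X i = (q * content lam X (Suc i) - inverse q * content lam X i) /
    (content lam X (Suc i) - content lam X i)"

text \<open>The transposition preserves the order of every pair of positions other than \<open>(i, i + 1)\<close>, so the
  two norms share all their factors except the one of this pair, which is \<open>swap_coeff\<close>.\<close>

lemma swap_coeff_tableau_norm:
  assumes lam: "multipartition m n lam"
    and X: "X \<in> standard_tableaux lam" and Y: "swap_entries i X \<in> standard_tableaux lam"
    and i: "1 \<le> i" "i < n"
  shows "swap_coeff lam X i * tableau_norm n lam (swap_entries i X) =
    swap_coeff lam (swap_entries i X) i * tableau_norm n lam X"
proof -
  define t where "t = transpose i (Suc i)"
  define D where "D c = {(j, k). 1 \<le> j \<and> j < k \<and> k \<le> n \<and> c j \<noteq> c k \<and>
      c j \<noteq> c k * q powi 2 \<and> c j \<noteq> c k * q powi (-2)}" for c :: "nat \<Rightarrow> ratfun"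
  define E where "E c = D c - {(i, Suc i)}" for c
  define f where "f c = (\<lambda>(j, k). (inverse q * c j - q * c k) / (c j - c k))" for c :: "nat \<Rightarrow> ratfun"
  have fin: "finite (D c)" for c
    by (rule finite_subset[of _ "{1..n} \<times> {1..n}"]) (auto simp: D_def)
  have norm: "tableau_norm n lam Z = swap_coeff lam Z i * prod (f (content lam Z)) (E (content lam Z))"
    if Z: "Z \<in> standard_tableaux lam" and Z': "swap_entries i Z \<in> standard_tableaux lam" for Z
  proof -
    have "(i, Suc i) \<in> D (content lam Z)"
      using swappable_contents[OF lam Z Z' i, of 0] swappable_contents[OF lam Z Z' i, of 1]
        swappable_contents[OF lam Z Z' i, of "-1"] i
      by (auto simp: D_def)
    moreover have "tableau_norm n lam Z = prod (f (content lam Z)) (D (content lam Z))"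
      by (simp add: tableau_norm_def D_def f_def Let_def)
    ultimately have "tableau_norm n lam Z = f (content lam Z) (i, Suc i) * prod (f (content lam Z)) (E (content lam Z))"
      unfolding E_def using fin by (simp add: prod.remove)
    \<comment> \<open>The two fractions agree after changing the signs of numerator and
      denominator.\<close>
    moreover have "f (content lam Z) (i, Suc i) = swap_coeff lam Z i"
      unfolding f_def swap_coeff_def prod.case by (metis minus_diff_eq minus_divide_divide)
    ultimately show ?thesis by simp
  qed
  let ?c = "content lam X" and ?c' = "content lam (swap_entries i X)"
  have tt: "t (t j) = j" for j by (simp add: t_def)
  have bound: "1 \<le> t j \<and> t j \<le> n" if "1 \<le> j" "j \<le> n" for j
    using that i by (auto simp: t_def transpose_def)
  have c': "?c' j = ?c (t j)" if "1 \<le> j" "j \<le> n" for j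
    unfolding t_def by (rule content_swap_entries[OF lam X Y i that])
  have mono: "t j < t k" if "j < k" "(j, k) \<noteq> (i, Suc i)" for j k
    using that by (auto simp: t_def transpose_def)
  \<comment> \<open>Applying \<open>t\<close> would give \<open>(j, k) = (Suc i, i)\<close>, against
    \<open>j < k\<close>. Hence reindexing by \<open>t\<close> never reaches the removed
    pair.\<close>
  have ne: "(t j, t k) \<noteq> (i, Suc i)" if "j < k" for j k
    using that by (auto simp: t_def transpose_def split: if_splits)
  have "prod (f ?c) (E ?c) = prod (f ?c') (E ?c')"
  proof (rule prod.reindex_bij_witness[of _ "map_prod t t" "map_prod t t"])
    fix p assume "p \<in> E ?c"
    then obtain j k where p: "p = (j, k)" "1 \<le> j" "j < k" "k \<le> n" "(j, k) \<noteq> (i, Suc i)"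
      and D: "(j, k) \<in> D ?c"
      by (auto simp: E_def D_def)
    have b: "1 \<le> t j" "t k \<le> n" "t j \<le> n" "1 \<le> t k" using bound[of j] bound[of k] p by auto
    have e: "?c' (t j) = ?c j" "?c' (t k) = ?c k" using c'[of "t j"] c'[of "t k"] b tt by auto
    show "map_prod t t p \<in> E ?c'"
      using D b mono[OF p(3,5)] ne[OF p(3)] unfolding E_def D_def p(1) by (simp add: e)
    show "f ?c' (map_prod t t p) = f ?c p" by (simp add: f_def p(1) e)
    show "map_prod t t (map_prod t t p) = p" by (simp add: p(1) tt)
  next
    fix p assume "p \<in> E ?c'"
    then obtain j k where p: "p = (j, k)" "1 \<le> j" "j < k" "k \<le> n" "(j, k) \<noteq> (i, Suc i)"
      and D: "(j, k) \<in> D ?c'"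
      by (auto simp: E_def D_def)
    have b: "1 \<le> t j" "t k \<le> n" "t j \<le> n" "1 \<le> t k" using bound[of j] bound[of k] p by auto
    have e: "?c' j = ?c (t j)" "?c' k = ?c (t k)" using c'[of j] c'[of k] p by auto
    show "map_prod t t p \<in> E ?c"
      using D b mono[OF p(3,5)] ne[OF p(3)] unfolding E_def D_def p(1) by (simp add: e)
    show "map_prod t t (map_prod t t p) = p" by (simp add: p(1) tt)
  qed
  \<comment> \<open>Both sides become the product of the two swap coefficients with the common
    product; the norm formula for the swapped tableau needs that swapping again returns
    \<open>X\<close>.\<close>
  then show ?thesis
    using norm[OF X Y] norm[OF Y] X by (simp add: swap_entries_involutory)
qed

section \<open>Invertibility of the generators\<close>

lemma scal_letter_commute: "scal r * letter g = letter g * scal r"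
  by (simp add: scal_def letter_def mult_single)

lemma scal_mult: "scal r * scal r' = scal (r * r')"
  by (simp add: scal_def mult_single)

lemma scal_1: "scal 1 = 1"
  by (simp add: scal_def single_one)

lemma free_algebra_minus:
  assumes "a \<in> carrier (free_algebra (ground_ring m n) G)" "b \<in> carrier (free_algebra (ground_ring m n) G)"
  shows "a \<ominus>\<^bsub>free_algebra (ground_ring m n) G\<^esub> b = a - b"
proof -
  interpret ring "free_algebra (ground_ring m n) G" by (rule free_algebra_ring)
  have "(a \<ominus>\<^bsub>free_algebra (ground_ring m n) G\<^esub> b) \<oplus>\<^bsub>free_algebra (ground_ring m n) G\<^esub> b = a"
    using assms by algebra
  then show ?thesis by (simp add: free_algebra_def eq_diff_eq)
qed

lemma free_algebra_closed:
  fixes m n :: nat and G :: "'g set"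
  defines "F \<equiv> free_algebra (ground_ring m n) G"
  assumes "a \<in> carrier F" "b \<in> carrier F"
  shows "a + b \<in> carrier F" "a - b \<in> carrier F" "a * b \<in> carrier F"
proof -
  interpret ring F unfolding F_def by (rule free_algebra_ring)
  show "a + b \<in> carrier F" "a * b \<in> carrier F"
    using add.m_closed[OF assms(2,3)] m_closed[OF assms(2,3)] by (simp_all add: F_def free_algebra_def)
  show "a - b \<in> carrier F"
    using minus_closed[OF assms(2,3)] free_algebra_minus assms(2,3) unfolding F_def by metis
qed

lemma free_algebra_one: "1 \<in> carrier (free_algebra (ground_ring m n) G)"
  using ring.ring_simprules(6)[OF free_algebra_ring, of m n G] by (simp add: free_algebra_def)

lemma hecke_ideal_ideal: "ideal (hecke_ideal m n) (hecke_free m n)"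
  by (intro ring.genideal_ideal free_algebra_ring relators_closed)

lemma relator_in_hecke_ideal: "x \<in> relators m n \<Longrightarrow> x \<in> hecke_ideal m n"
  using ring.genideal_self[OF free_algebra_ring relators_closed] by blast

lemma hecke_gen_closed: "g \<in> gens n \<Longrightarrow> hecke_gen m n g \<in> carrier (hecke m n)"
  unfolding hecke_def hecke_gen_def FactRing_def
  by (auto simp: A_RCOSETS_def' intro: letter_closed)

lemma hecke_scal_closed: "r \<in> carrier (ground_ring m n) \<Longrightarrow> hecke_scal m n r \<in> carrier (hecke m n)"
  unfolding hecke_def hecke_scal_def FactRing_def
  by (auto simp: A_RCOSETS_def' intro: scal_closed)

lemma hecke_mult:
  assumes "a \<in> carrier (hecke_free m n)" "b \<in> carrier (hecke_free m n)"
  shows "(hecke_ideal m n +>\<^bsub>hecke_free m n\<^esub> a) \<otimes>\<^bsub>hecke m n\<^esub> (hecke_ideal m n +>\<^bsub>hecke_free m n\<^esub> b) =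
    hecke_ideal m n +>\<^bsub>hecke_free m n\<^esub> (a * b)"
  unfolding hecke_def FactRing_def
  using ideal.rcoset_mult_add[OF hecke_ideal_ideal assms] by (simp add: free_algebra_def)

lemma hecke_scal_gen_commute:
  assumes "g \<in> gens n" "r \<in> carrier (ground_ring m n)"
  shows "hecke_gen m n g \<otimes>\<^bsub>hecke m n\<^esub> hecke_scal m n r = hecke_scal m n r \<otimes>\<^bsub>hecke m n\<^esub> hecke_gen m n g"
  using letter_closed[OF assms(1), of m n] scal_closed[OF assms(2), of "gens n"]
  by (simp add: hecke_gen_def hecke_scal_def hecke_mult scal_letter_commute)

text \<open>Since \<open>p\<close> commutes with the letter, a single congruence makes its class a
  two-sided inverse.\<close>

lemma hecke_gen_unitI:
  assumes g: "g \<in> gens n" and p: "p \<in> carrier (hecke_free m n)"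
    and comm: "p * letter g = letter g * p"
    and rel: "letter g * p - 1 \<in> hecke_ideal m n"
  shows "hecke_gen m n g \<in> Units (hecke m n)"
proof -
  have l: "letter g \<in> carrier (hecke_free m n)" by (rule letter_closed[OF g])
  have eq: "hecke_ideal m n +>\<^bsub>hecke_free m n\<^esub> (letter g * p) = \<one>\<^bsub>hecke m n\<^esub>"
  proof -
    have "hecke_ideal m n +>\<^bsub>hecke_free m n\<^esub> (letter g * p) = hecke_ideal m n +>\<^bsub>hecke_free m n\<^esub> 1"
      using ring.quotient_eq_iff_same_a_r_cos[OF free_algebra_ring hecke_ideal_ideal
          free_algebra_closed(3)[OF l p] free_algebra_one] rel
      by (simp add: free_algebra_minus free_algebra_closed(3)[OF l p] free_algebra_one)
    then show ?thesis by (simp add: hecke_def FactRing_def free_algebra_def)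
  qed
  have "hecke_ideal m n +>\<^bsub>hecke_free m n\<^esub> p \<in> carrier (hecke m n)"
    unfolding hecke_def FactRing_def using p by (auto simp: A_RCOSETS_def')
  then show ?thesis
    unfolding Units_def using hecke_gen_closed[OF g, of m]
    by (auto simp: hecke_gen_def hecke_mult l p comm eq intro!: bexI[of _ "hecke_ideal m n +>\<^bsub>hecke_free m n\<^esub> p"])
qed

text \<open>The quadratic relation says that \<open>Sigma i\<close> times \<open>Sigma i\<close>
  minus \<open>q - inverse q\<close> is 1, so the second factor is the inverse.\<close>

lemma hecke_gen_Sigma_unit:
  assumes "1 \<le> i" "i < n"
  shows "hecke_gen m n (Sigma i) \<in> Units (hecke m n)"
proof (rule hecke_gen_unitI)
  let ?s = "letter (Sigma i)" and ?c = "scal (q - inverse q)"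
  show g: "Sigma i \<in> gens n" using assms by (auto simp: gens_def)
  have "q - inverse q \<in> carrier (ground_ring m n)"
    by (intro laurent_subset_ground_ring laurent_diff laurent.q laurent.q_inverse)
  then show "?s - ?c \<in> carrier (hecke_free m n)"
    by (intro free_algebra_closed letter_closed g scal_closed)
  show "(?s - ?c) * ?s = ?s * (?s - ?c)"
    by (simp add: algebra_simps scal_letter_commute)
  have "?s * ?s - (?c * ?s + 1) \<in> relators m n"
    unfolding relators_def Let_def using assms by auto
  then show "?s * (?s - ?c) - 1 \<in> hecke_ideal m n"
    using relator_in_hecke_ideal by (simp add: algebra_simps scal_letter_commute)
qed

text \<open>Isolates the constant term of a product of linear factors. The remaining cofactor is
  built from \<open>letter g\<close> and scalars, hence commutes with the letter.\<close>

lemma cyclotomic_product: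
  fixes g :: 'g
  assumes "g \<in> G" "\<And>j. j \<in> set js \<Longrightarrow> a j \<in> carrier (ground_ring m n)"
  shows "\<exists>p\<in>carrier (free_algebra (ground_ring m n) G). p * letter g = letter g * p \<and>
    prod_list (map (\<lambda>j. letter g - scal (a j)) js) = letter g * p + scal (\<Prod>j\<leftarrow>js. - a j)"
  using assms(2)
proof (induction js)
  case Nil
  show ?case
    by (rule bexI[of _ 0]) (simp_all add: scal_1 free_algebra_def ground_ring_closed)
next
  case (Cons j js)
  let ?c = "\<Prod>j\<leftarrow>js. - a j"
  obtain p where p: "p \<in> carrier (free_algebra (ground_ring m n) G)" "p * letter g = letter g * p"
    "prod_list (map (\<lambda>j. letter g - scal (a j)) js) = letter g * p + scal ?c"
    using Cons by auto
  have aj: "a j \<in> carrier (ground_ring m n)" using Cons.prems by simp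
  have c: "?c \<in> carrier (ground_ring m n)"
    using Cons.prems by (induction js) (auto intro: ground_ring_closed ground_ring_uminus simp del: mult_minus_left)
  \<comment> \<open>Read off from
    \<open>(g - a) * (g * p + c) = g * (g * p + c - a * p) - a * c\<close>.\<close>
  let ?p = "letter g * p + scal ?c - scal (a j) * p"
  have sl: "scal r * (letter g * x) = letter g * (scal r * x)" for r and x :: "'g free_alg"
    by (simp add: scal_letter_commute flip: mult.assoc)
  have "scal (- a j * ?c) = - (scal (a j) * scal ?c)"
    by (simp add: scal_def mult_single single_uminus)
  then have const: "scal (\<Prod>j\<leftarrow>j # js. - a j) = - (scal (a j) * scal ?c)"
    by simp
  have "prod_list (map (\<lambda>j. letter g - scal (a j)) (j # js)) = letter g * ?p - scal (a j) * scal ?c"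
    by (simp add: p(3) algebra_simps sl)
  then have "prod_list (map (\<lambda>j. letter g - scal (a j)) (j # js)) = letter g * ?p + scal (\<Prod>j\<leftarrow>j # js. - a j)"
    unfolding const by simp
  moreover have "?p * letter g = letter g * ?p"
    by (simp add: algebra_simps sl p(2) scal_letter_commute)
  moreover have "?p \<in> carrier (free_algebra (ground_ring m n) G)"
    by (intro free_algebra_closed letter_closed scal_closed assms(1) p(1) aj c)
  ultimately show ?case by blast
qed

text \<open>The constant term of the cyclotomic relation is a product of the units \<open>- v\<^sub>j\<close>.\<close>

lemma hecke_gen_Tau_unit: "hecke_gen m n Tau \<in> Units (hecke m n)"
proof -
  have g: "Tau \<in> gens n" by (simp add: gens_def)
  let ?js = "[1..<Suc m]" and ?t = "letter Tau"
  let ?c = "\<Prod>j\<leftarrow>?js. - v j"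
  have v: "v j \<in> carrier (ground_ring m n)" if "j \<in> set ?js" for j
    using that by (intro laurent_subset_ground_ring laurent.v) auto
  obtain p where p: "p \<in> carrier (hecke_free m n)" "p * ?t = ?t * p"
    "prod_list (map (\<lambda>j. ?t - scal (v j)) ?js) = ?t * p + scal ?c"
    using cyclotomic_product[of Tau "gens n" ?js v m n, OF g v] by blast
  have c0: "?c \<noteq> 0" by (auto simp: prod_list_zero_iff v_nonzero simp del: upt_Suc)
  have "inverse (\<Prod>j\<leftarrow>js. - v j) \<in> laurent m" if "set js \<subseteq> {1..m}" for js
    using that by (induction js) (auto intro: laurent_1 laurent.mult laurent_uminus laurent.v_inverse
        simp del: One_nat_def)
  then have "inverse ?c \<in> laurent m"
    by (metis atLeastLessThanSuc_atLeastAtMost order_refl set_upt)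
  then have "- inverse ?c \<in> carrier (ground_ring m n)"
    by (intro laurent_subset_ground_ring laurent_uminus)
  then have d: "scal (- inverse ?c) \<in> carrier (hecke_free m n)"
    by (rule scal_closed)
  have rel: "?t * p + scal ?c \<in> hecke_ideal m n"
    unfolding p(3)[symmetric] by (rule relator_in_hecke_ideal) (simp add: relators_def Let_def)
  show ?thesis
  proof (rule hecke_gen_unitI[OF g])
    let ?p = "scal (- inverse ?c) * p"
    show "?p \<in> carrier (hecke_free m n)" by (intro free_algebra_closed d p(1))
    show "?p * ?t = ?t * ?p"
      by (simp add: mult.assoc p(2)) (simp add: scal_letter_commute flip: mult.assoc)
    \<comment> \<open>Dividing the relation \<open>?t * p + ?c = 0\<close> by \<open>- ?c\<close>
      leaves \<open>?t * ?p - 1\<close>.\<close>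
    have "scal (- inverse ?c) * (?t * p + scal ?c) \<in> hecke_ideal m n"
      using ideal.I_l_closed[OF hecke_ideal_ideal rel d] by (simp add: free_algebra_def)
    moreover have "scal (- inverse c) * scal c = - 1" if "c \<noteq> 0" for c
      unfolding scal_mult using that by (simp add: scal_def single_uminus single_one)
    from this[OF c0] have "scal (- inverse ?c) * (?t * p + scal ?c) = ?t * ?p - 1"
      by (simp add: distrib_left scal_letter_commute flip: mult.assoc)
    ultimately show "?t * ?p - 1 \<in> hecke_ideal m n" by simp
  qed
qed

lemma hecke_gen_unit: "g \<in> gens n \<Longrightarrow> hecke_gen m n g \<in> Units (hecke m n)"
  using hecke_gen_Sigma_unit hecke_gen_Tau_unit by (auto simp: gens_def)

section \<open>Linear maps and forms in coordinates\<close>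

lemma tableau_module_ops:
  "u \<oplus>\<^bsub>tableau_module m n lam\<^esub> w = (\<lambda>X. u X + w X)"
  "r \<odot>\<^bsub>tableau_module m n lam\<^esub> u = (\<lambda>X. r * u X)"
  by (simp_all add: tableau_module_def)

lemma ground_ring_ops:
  "x \<oplus>\<^bsub>ground_ring m n\<^esub> y = x + y" "x \<otimes>\<^bsub>ground_ring m n\<^esub> y = x * y"
  by (simp_all add: ground_ring_def)

lemma tableau_module_closed:
  "u \<in> carrier (tableau_module m n lam) \<Longrightarrow> u X \<in> carrier (ground_ring m n)"
  by (simp add: tableau_module_def)

text \<open>Serves for either argument of the form and for each coordinate of the action of a
  generator.\<close>

lemma linear_functional_expand:
  fixes L :: "(tableau \<Rightarrow> ratfun) \<Rightarrow> ratfun"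
  assumes add: "\<And>u w. u \<in> carrier (tableau_module m n lam) \<Longrightarrow> w \<in> carrier (tableau_module m n lam) \<Longrightarrow>
      L (\<lambda>X. u X + w X) = L u + L w"
    and scale: "\<And>r u. r \<in> carrier (ground_ring m n) \<Longrightarrow> u \<in> carrier (tableau_module m n lam) \<Longrightarrow>
      L (\<lambda>X. r * u X) = r * L u"
    and u: "u \<in> carrier (tableau_module m n lam)"
  shows "L u = (\<Sum>X\<in>standard_tableaux lam. u X * L (basis_vec lam X))"
proof -
  let ?U = "carrier (tableau_module m n lam)"
  have summand: "(\<lambda>Y. u X * basis_vec lam X Y) \<in> ?U" for X
    using u by (auto simp: tableau_module_def basis_vec_def ground_ring_closed)
  have part: "(\<lambda>Y. \<Sum>X\<in>A. u X * basis_vec lam X Y) \<in> ?U \<and>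
      L (\<lambda>Y. \<Sum>X\<in>A. u X * basis_vec lam X Y) = (\<Sum>X\<in>A. u X * L (basis_vec lam X))"
    if "finite A" for A
    using that
  proof (induction A)
    case empty
    show ?case
      \<comment> \<open>The value at the zero vector comes from scaling \<open>u\<close> by
        0.\<close>
      using scale[OF ground_ring_closed(1) u] by (simp add: tableau_module_def ground_ring_closed)
  next
    case (insert X A)
    then have "L (\<lambda>Y. u X * basis_vec lam X Y + (\<Sum>X\<in>A. u X * basis_vec lam X Y)) =
        u X * L (basis_vec lam X) + (\<Sum>X\<in>A. u X * L (basis_vec lam X))"
      using add[OF summand] scale[OF tableau_module_closed[OF u] basis_vec_closed] by simp
    moreover have "(\<lambda>Y. u X * basis_vec lam X Y + (\<Sum>X\<in>A. u X * basis_vec lam X Y)) \<in> ?U"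
      using insert summand[of X] by (auto simp: tableau_module_def intro: ground_ring_closed)
    ultimately show ?case using insert.hyps by simp
  qed
  have "(\<Sum>X\<in>standard_tableaux lam. u X * basis_vec lam X Y) = u Y" for Y
  proof -
    have "(\<Sum>X\<in>standard_tableaux lam. u X * basis_vec lam X Y) =
        (\<Sum>X\<in>standard_tableaux lam. if Y = X then u X else 0)"
      by (rule sum.cong) (auto simp: basis_vec_def)
    also have "\<dots> = u Y"
      using u by (auto simp: sum.delta' finite_standard_tableaux tableau_module_def)
    finally show ?thesis .
  qed
  then show ?thesis using part[OF finite_standard_tableaux, of lam] by simp
qed

text \<open>Bilinearity and the values on basis vectors determine the form on the carrier, so this
  is also its uniqueness.\<close>

lemma tableau_form_expand:
  assumes B: "tableau_form m n lam B"
    and u: "u \<in> carrier (tableau_module m n lam)" and w: "w \<in> carrier (tableau_module m n lam)"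
  shows "B u w = (\<Sum>X\<in>standard_tableaux lam. u X * w X * tableau_norm n lam X)"
proof -
  have bil: "bilinear_form (ground_ring m n) (tableau_module m n lam) B"
    and orth: "\<And>X Y. X \<in> standard_tableaux lam \<Longrightarrow> Y \<in> standard_tableaux lam \<Longrightarrow>
      B (basis_vec lam X) (basis_vec lam Y) = (if X = Y then tableau_norm n lam X else 0)"
    using B unfolding tableau_form_def by auto
  note bil = bil[unfolded bilinear_form_def tableau_module_ops ground_ring_ops]
  have "B u w = (\<Sum>X\<in>standard_tableaux lam. u X * B (basis_vec lam X) w)"
    by (rule linear_functional_expand[where L = "\<lambda>u. B u w", OF _ _ u]) (use bil w in auto)
  also have "\<dots> = (\<Sum>X\<in>standard_tableaux lam. u X * w X * tableau_norm n lam X)"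
  proof (rule sum.cong[OF refl])
    fix X assume X: "X \<in> standard_tableaux lam"
    have "B (basis_vec lam X) w = (\<Sum>Y\<in>standard_tableaux lam. w Y * B (basis_vec lam X) (basis_vec lam Y))"
      by (rule linear_functional_expand[OF _ _ w]) (use bil basis_vec_closed in auto)
    also have "\<dots> = (\<Sum>Y\<in>standard_tableaux lam. if X = Y then w Y * tableau_norm n lam Y else 0)"
      by (rule sum.cong) (auto simp: orth X)
    also have "\<dots> = w X * tableau_norm n lam X"
      using X by (simp add: sum.delta' finite_standard_tableaux)
    finally show "u X * B (basis_vec lam X) w = u X * w X * tableau_norm n lam X"
      by (simp add: mult.assoc)
  qed
  finally show ?thesis .
qed

lemma tableau_form_exists:
  assumes lam: "multipartition m n lam"
  shows "\<exists>B. tableau_form m n lam B"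
proof -
  let ?B = "\<lambda>u w. \<Sum>X\<in>standard_tableaux lam. u X * w X * tableau_norm n lam X"
  have "bilinear_form (ground_ring m n) (tableau_module m n lam) ?B"
    unfolding bilinear_form_def tableau_module_ops ground_ring_ops
  proof (intro conjI ballI)
    fix u w assume "u \<in> carrier (tableau_module m n lam)" "w \<in> carrier (tableau_module m n lam)"
    then show "?B u w \<in> carrier (ground_ring m n)"
      by (intro ground_ring_sum ground_ring_closed tableau_norm_closed[OF lam]) (auto dest: tableau_module_closed)
  qed (simp_all add: algebra_simps sum.distrib sum_distrib_left)
  moreover have "?B (basis_vec lam X) (basis_vec lam Y) = (if X = Y then tableau_norm n lam X else 0)"
    if X: "X \<in> standard_tableaux lam" "Y \<in> standard_tableaux lam" for X Y
  proof -
    have "?B (basis_vec lam X) (basis_vec lam Y) =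
        (\<Sum>Z\<in>standard_tableaux lam. if X = Z then (if X = Y then tableau_norm n lam X else 0) else 0)"
      by (rule sum.cong) (auto simp: basis_vec_def X)
    then show ?thesis using X by (simp add: sum.delta' finite_standard_tableaux)
  qed
  ultimately show ?thesis unfolding tableau_form_def by blast
qed

section \<open>Invariance\<close>

context
  fixes m n :: nat and lam :: "nat list list"
    and act :: "gen free_alg set \<Rightarrow> (tableau \<Rightarrow> ratfun) \<Rightarrow> (tableau \<Rightarrow> ratfun)"
  assumes lam: "multipartition m n lam" and action: "tableau_action m n lam act"
begin

section \<open>The action in coordinates and self-adjointness\<close>

lemma act_rules:
  assumes "h \<in> carrier (hecke m n)" "u \<in> carrier (tableau_module m n lam)"
  shows act_closed: "act h u \<in> carrier (tableau_module m n lam)"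
    and act_add: "w \<in> carrier (tableau_module m n lam) \<Longrightarrow> act h (\<lambda>X. u X + w X) = (\<lambda>X. act h u X + act h w X)"
    and act_mult: "g \<in> carrier (hecke m n) \<Longrightarrow> act (h \<otimes>\<^bsub>hecke m n\<^esub> g) u = act h (act g u)"
    and act_one: "act \<one>\<^bsub>hecke m n\<^esub> u = u"
    and act_scal: "r \<in> carrier (ground_ring m n) \<Longrightarrow> act (hecke_scal m n r) u = (\<lambda>X. r * u X)"
  using action assms unfolding tableau_action_def algebra_action_def tableau_module_ops by blast+

text \<open>Scalars act through central elements of the algebra, so compatibility with products
  moves them past a generator.\<close>

lemma act_gen_scale:
  assumes "g \<in> gens n" "r \<in> carrier (ground_ring m n)" "u \<in> carrier (tableau_module m n lam)"
  shows "act (hecke_gen m n g) (\<lambda>X. r * u X) = (\<lambda>X. r * act (hecke_gen m n g) u X)"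
proof -
  let ?h = "hecke_gen m n g" and ?s = "hecke_scal m n r"
  have h: "?h \<in> carrier (hecke m n)" and s: "?s \<in> carrier (hecke m n)"
    using assms by (auto intro: hecke_gen_closed hecke_scal_closed)
  have "act ?h (\<lambda>X. r * u X) = act (?h \<otimes>\<^bsub>hecke m n\<^esub> ?s) u"
    using act_scal[OF s assms(3,2)] act_mult[OF h assms(3) s] by simp
  also have "\<dots> = act ?s (act ?h u)"
    using act_mult[OF s assms(3) h] hecke_scal_gen_commute[OF assms(1,2)] by simp
  also have "\<dots> = (\<lambda>X. r * act ?h u X)"
    by (rule act_scal[OF s act_closed[OF h assms(3)] assms(2)])
  finally show ?thesis .
qed

lemma act_gen_expand:
  assumes g: "g \<in> gens n" and u: "u \<in> carrier (tableau_module m n lam)"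
  shows "act (hecke_gen m n g) u Y =
    (\<Sum>X\<in>standard_tableaux lam. u X * act (hecke_gen m n g) (basis_vec lam X) Y)"
  by (rule linear_functional_expand[where L = "\<lambda>u. act (hecke_gen m n g) u Y", OF _ _ u])
     (simp_all add: act_add[OF hecke_gen_closed[OF g]] act_gen_scale[OF g])

text \<open>Self-adjointness on basis vectors: weighted by the diagonal Gram matrix, the matrix of a
  generator is symmetric. Only entries joining a tableau to its swap need an argument, and there it
  is \<open>swap_coeff_tableau_norm\<close>.\<close>

lemma act_gen_matrix_symmetric:
  assumes g: "g \<in> gens n" and X: "X \<in> standard_tableaux lam" and Y: "Y \<in> standard_tableaux lam"
  shows "act (hecke_gen m n g) (basis_vec lam X) Y * tableau_norm n lam Y =
    act (hecke_gen m n g) (basis_vec lam Y) X * tableau_norm n lam X"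
proof (cases "X = Y")
  case False
  show ?thesis
  proof (cases g)
    case Tau
    have "act (hecke_gen m n Tau) (basis_vec lam Z) Z' = content lam Z 1 * basis_vec lam Z Z'"
      if "Z \<in> standard_tableaux lam" for Z Z'
      using action that unfolding tableau_action_def Let_def tableau_module_ops by simp
    with False X Y Tau show ?thesis by (simp add: basis_vec_def)
  next
    case (Sigma i)
    with g have i: "1 \<le> i" "i < n" by (auto simp: gens_def)
    have entry: "act (hecke_gen m n g) (basis_vec lam Z) Z' =
        (if Z' = swap_entries i Z then swap_coeff lam Z i else 0)"
      if "Z \<in> standard_tableaux lam" "Z' \<in> standard_tableaux lam" "Z \<noteq> Z'" for Z Z'
      using action that i unfolding tableau_action_def Let_def tableau_module_ops Sigma
      by (auto simp: basis_vec_def swap_coeff_def)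
    show ?thesis
    proof (cases "Y = swap_entries i X")
      case True
      then have "X = swap_entries i Y" by (simp add: swap_entries_involutory)
      then show ?thesis
        using swap_coeff_tableau_norm[OF lam X _ i] True X Y False by (simp add: entry)
    next
      case 2: False
      then have "X \<noteq> swap_entries i Y" by (auto simp: swap_entries_involutory)
      with 2 show ?thesis using False X Y by (simp add: entry)
    qed
  qed
qed simp

lemma act_gen_self_adjoint:
  assumes B: "tableau_form m n lam B" and g: "g \<in> gens n"
    and u: "u \<in> carrier (tableau_module m n lam)" and w: "w \<in> carrier (tableau_module m n lam)"
  shows "B (act (hecke_gen m n g) u) w = B u (act (hecke_gen m n g) w)"
proof -
  let ?S = "standard_tableaux lam" and ?N = "tableau_norm n lam"
  let ?M = "\<lambda>X Y. act (hecke_gen m n g) (basis_vec lam X) Y"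
  note cl = act_closed[OF hecke_gen_closed[OF g]]
  have "B (act (hecke_gen m n g) u) w = (\<Sum>Y\<in>?S. \<Sum>X\<in>?S. u X * w Y * (?M X Y * ?N Y))"
    by (simp add: tableau_form_expand[OF B cl[OF u] w] act_gen_expand[OF g u] sum_distrib_right
        sum_distrib_left mult.assoc mult.left_commute)
  \<comment> \<open>Weighted symmetry of the matrix is applied term by term.\<close>
  also have "\<dots> = (\<Sum>Y\<in>?S. \<Sum>X\<in>?S. u X * w Y * (?M Y X * ?N X))"
    by (intro sum.cong refl) (simp add: act_gen_matrix_symmetric[OF g])
  also have "\<dots> = (\<Sum>X\<in>?S. \<Sum>Y\<in>?S. u X * w Y * (?M Y X * ?N X))"
    by (rule sum.swap)
  also have "\<dots> = B u (act (hecke_gen m n g) w)"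
    by (simp add: tableau_form_expand[OF B u cl[OF w]] act_gen_expand[OF g w] sum_distrib_right
        sum_distrib_left mult.assoc mult.left_commute)
  finally show ?thesis .
qed

text \<open>Self-adjointness moves the generator to the second argument, where it cancels its
  inverse.\<close>

lemma tableau_form_minus_invariant:
  assumes B: "tableau_form m n lam B"
  shows "minus_invariant (hecke m n) act (hecke_gen m n ` gens n) (tableau_module m n lam) B"
  unfolding minus_invariant_def
proof (intro ballI, elim imageE, hypsubst)
  fix g u w
  assume g: "g \<in> gens n"
    and u: "u \<in> carrier (tableau_module m n lam)" and w: "w \<in> carrier (tableau_module m n lam)"
  let ?h = "hecke_gen m n g"
  interpret H: ring "hecke m n" by (rule hecke_ring)
  have unit: "?h \<in> Units (hecke m n)" by (rule hecke_gen_unit[OF g])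
  note h = hecke_gen_closed[OF g] and h' = H.Units_inv_closed[OF unit]
  have "act ?h (act (inv\<^bsub>hecke m n\<^esub> ?h) w) = w"
    using act_mult[OF h w h'] act_one[OF h w] H.Units_r_inv[OF unit] by simp
  then show "B (act ?h u) (act (inv\<^bsub>hecke m n\<^esub> ?h) w) = B u w"
    by (simp add: act_gen_self_adjoint[OF B g u act_closed[OF h' w]])
qed

end

text \<open>The first conjunct ensures that the quantification over forms in the second is not
  vacuous.\<close>

theorem proposition11:
  fixes m n :: nat
    and lam :: "nat list list"
    and act :: "gen free_alg set \<Rightarrow> (tableau \<Rightarrow> ratfun) \<Rightarrow> (tableau \<Rightarrow> ratfun)"
  assumes "1 \<le> m" and "1 \<le> n"
    and "multipartition m n lam"
    and "tableau_action m n lam act"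
  shows "(\<exists>B. tableau_form m n lam B) \<and>
    (\<forall>B. tableau_form m n lam B \<longrightarrow>
      minus_invariant (hecke m n) act (hecke_gen m n ` gens n) (tableau_module m n lam) B)"
  using tableau_form_exists tableau_form_minus_invariant assms(3,4) by blast

end
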